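(* For every $w\ge 2$, a fan-in-$w$ AND gate $a_0\wedge a_1\wedge\dots\wedge a_{w-1}$ of secret bits can be evaluated by three parties (KH, EVH and one helper), with pre-shared keys and perfect security against each single party, in $2$ rounds using messages of size $O(2^{w})$ bits and $O(w2^{w})$ bit operations.
   Context: For bits $m,K\in\{0,1\}$: $ENC_K(m):=K\oplus m$ (XOR). Model: three semi-honest parties, a key holder (KH), an encrypted value holder (EVH) and a helper, communicate over perfectly secure channels in synchronous rounds. Initially, for each $i$, the EVH holds $ENC_{K_i}(a_i)$ and the KH holds $K_i$, with the $K_i$ independent uniformly random bits; this initial distribution by the client is not part of the computation. Pairs of parties have pre-shared randomness: keys (independent uniformly random bits) known to two of the parties do not have to be transmitted. Evaluating the gate means that at the end the EVH holds a bit $c$ and the KH holds a bit $k$ with $c\oplus k=a_0\wedge a_1\wedge\dots\wedge a_{w-1}$. Perfect security against each single party means that for each of the three parties, the joint distribution of everything it holds and receives does not depend on $(a_0,\dots,a_{w-1})$. *)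

theory Defs
  imports "HOL-Probability.Probability_Mass_Function" "HOL-Library.Landau_Symbols" "HOL-Library.Sublist"
begin

section \<open>Bit operations\<close>

text \<open>
  A party's local computation is a straight-line program over an append-only bit memory:
  every instruction reads earlier addresses and appends one new bit, and counts as one bit
  operation. Programs are oblivious (no data-dependent addresses), i.e. Boolean circuits of
  fan-in at most two.
\<close>

datatype instr = NotI nat | AndI nat nat | OrI nat nat | XorI nat nat

type_synonym memory = "bool list"

text \<open>Addresses beyond the end of the memory read as 0.\<close>

definition read :: "memory \<Rightarrow> nat \<Rightarrow> bool" where
  "read m i \<longleftrightarrow> i < length m \<and> m ! i"

primrec eval_instr :: "memory \<Rightarrow> instr \<Rightarrow> bool" where
  "eval_instr m (NotI i) \<longleftrightarrow> \<not> read m i"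
| "eval_instr m (AndI i j) \<longleftrightarrow> read m i \<and> read m j"
| "eval_instr m (OrI i j) \<longleftrightarrow> read m i \<or> read m j"
| "eval_instr m (XorI i j) \<longleftrightarrow> read m i \<noteq> read m j"

definition run :: "instr list \<Rightarrow> memory \<Rightarrow> memory" where
  "run prog m = fold (\<lambda>c m. m @ [eval_instr m c]) prog m"

section \<open>Three-party protocols\<close>

datatype party = KH | EVH | Helper

datatype party_pair = KH_EVH | KH_Helper | EVH_Helper

text \<open>
  In a round, party \<open>p\<close> first runs \<open>ops r p\<close>, and then sends to every other party \<open>q\<close> the bits
  of its memory at the addresses \<open>sent r p q\<close>; the entries \<open>sent r p p\<close> are ignored.
  After the last round, \<open>p\<close> runs \<open>final_ops P p\<close>. The output bits \<open>c\<close> and \<open>k\<close>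
  are the bits at \<open>out_value P\<close> in the memory of EVH and at \<open>out_key P\<close> in that of KH.
  The only randomness besides the client's bits are \<open>num_keys P pr\<close> pre-shared random bits
  for each pair \<open>pr\<close> of parties.
\<close>

record comm_round =
  ops :: "party \<Rightarrow> instr list"
  sent :: "party \<Rightarrow> party \<Rightarrow> nat list"

record protocol =
  num_keys :: "party_pair \<Rightarrow> nat"
  rounds :: "comm_round list"
  final_ops :: "party \<Rightarrow> instr list"
  out_value :: nat
  out_key :: nat

definition others :: "party \<Rightarrow> party list" where
  "others q = filter (\<lambda>p. p \<noteq> q) [KH, EVH, Helper]"

text \<open>Synchrony: the messages of a round depend only on the memories before any delivery.\<close>

definition do_round :: "comm_round \<Rightarrow> (party \<Rightarrow> memory) \<Rightarrow> (party \<Rightarrow> memory)" where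
  "do_round r s = (let s' = (\<lambda>p. run (ops r p) (s p)) in
     (\<lambda>q. s' q @ concat (map (\<lambda>p. map (read (s' p)) (sent r p q)) (others q))))"

definition execute :: "protocol \<Rightarrow> (party \<Rightarrow> memory) \<Rightarrow> (party \<Rightarrow> memory)" where
  "execute P s = (\<lambda>p. run (final_ops P p) (fold do_round (rounds P) s p))"

definition enc :: "bool \<Rightarrow> bool \<Rightarrow> bool" where
  "enc K m \<longleftrightarrow> K \<noteq> m"

fun init :: "bool list \<Rightarrow> bool list \<Rightarrow> (party_pair \<Rightarrow> bool list) \<Rightarrow> party \<Rightarrow> memory" where
  "init a K R KH = K @ R KH_EVH @ R KH_Helper"
| "init a K R EVH = map2 enc K a @ R KH_EVH @ R EVH_Helper"
| "init a K R Helper = R KH_Helper @ R EVH_Helper"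

definition final_memory ::
    "protocol \<Rightarrow> bool list \<Rightarrow> bool list \<Rightarrow> (party_pair \<Rightarrow> bool list) \<Rightarrow> party \<Rightarrow> memory" where
  "final_memory P a K R = execute P (init a K R)"

text \<open>
  Independent uniformly random bits, jointly for the client's keys and all pre-shared keys,
  are the uniform distribution on this finite set.
\<close>

definition coins :: "nat \<Rightarrow> protocol \<Rightarrow> (bool list \<times> (party_pair \<Rightarrow> bool list)) set" where
  "coins w P = {(K, R). length K = w \<and> (\<forall>pr. length (R pr) = num_keys P pr)}"

definition evaluates_and :: "nat \<Rightarrow> protocol \<Rightarrow> bool" where
  "evaluates_and w P \<longleftrightarrow>
     (\<forall>a. length a = w \<longrightarrow> (\<forall>(K, R) \<in> coins w P.
        (read (final_memory P a K R EVH) (out_value P) \<noteq> read (final_memory P a K R KH) (out_key P))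
        = (\<forall>i<w. a ! i)))"

text \<open>
  As memories only grow, the final memory of a party records everything it held or received:
  its share of the input, its pre-shared keys, all received messages, everything it computed,
  and its output.
\<close>

definition view_dist :: "nat \<Rightarrow> protocol \<Rightarrow> bool list \<Rightarrow> party \<Rightarrow> memory pmf" where
  "view_dist w P a p = map_pmf (\<lambda>(K, R). final_memory P a K R p) (pmf_of_set (coins w P))"

definition perfectly_secure :: "nat \<Rightarrow> protocol \<Rightarrow> bool" where
  "perfectly_secure w P \<longleftrightarrow>
     (\<forall>p a b. length a = w \<and> length b = w \<longrightarrow> view_dist w P a p = view_dist w P b p)"

definition message_bits :: "protocol \<Rightarrow> nat" where
  "message_bits P =
     (\<Sum>r\<leftarrow>rounds P. \<Sum>q\<leftarrow>[KH, EVH, Helper]. \<Sum>p\<leftarrow>others q. length (sent r p q))"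

definition bit_operations :: "protocol \<Rightarrow> nat" where
  "bit_operations P =
     (\<Sum>r\<leftarrow>rounds P. \<Sum>p\<leftarrow>[KH, EVH, Helper]. length (ops r p)) +
     (\<Sum>p\<leftarrow>[KH, EVH, Helper]. length (final_ops P p))"

section \<open>Well-definedness\<close>

lemma UNIV_party_pair: "(UNIV :: party_pair set) = {KH_EVH, KH_Helper, EVH_Helper}"
  using party_pair.exhaust by blast

lemma finite_coins: "finite (coins w P)"
proof -
  have "finite (UNIV :: party_pair set)"
    by (simp add: UNIV_party_pair)
  then have "finite (PiE UNIV (\<lambda>pr. {xs :: bool list. length xs = num_keys P pr}))"
    using finite_lists_length_eq[of "UNIV :: bool set"] by (intro finite_PiE) auto
  moreover have "finite {K :: bool list. length K = w}"
    using finite_lists_length_eq[of "UNIV :: bool set" w] by simp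
  moreover have "coins w P =
      {K. length K = w} \<times> PiE UNIV (\<lambda>pr. {xs :: bool list. length xs = num_keys P pr})"
    by (auto simp: coins_def)
  ultimately show ?thesis
    by simp
qed

lemma coins_nonempty: "coins w P \<noteq> {}"
proof -
  have "(replicate w False, \<lambda>pr. replicate (num_keys P pr) False) \<in> coins w P"
    by (simp add: coins_def)
  then show ?thesis
    by blast
qed

lemma prefix_run: "prefix m (run prog m)"
proof (induction prog arbitrary: m)
  case Nil
  then show ?case
    by (simp add: run_def)
next
  case (Cons c prog)
  have "prefix (m @ [eval_instr m c]) (run (c # prog) m)"
    using Cons[of "m @ [eval_instr m c]"] by (simp add: run_def)
  then show ?case
    using append_prefixD by blast
qed

lemma prefix_do_round: "prefix (s p) (do_round r s p)"
  using prefix_run by (auto simp: do_round_def Let_def intro: prefix_order.trans)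

lemma prefix_execute: "prefix (s p) (execute P s p)"
proof -
  have "prefix (s p) (fold do_round rs s p)" for rs
    by (induction rs arbitrary: s) (auto intro: prefix_order.trans prefix_do_round)
  then show ?thesis
    unfolding execute_def using prefix_run prefix_order.trans by blast
qed

end

theory Submission
  imports Defs
begin

text \<open>
  With \<open>x\<close> the encrypted value and \<open>K\<close> the keys, the conjunction is the inner product over GF(2) of
  \<open>u\<^sub>j = [x = j]\<close>, known to EVH, and \<open>v\<^sub>j = [K = \<not> j]\<close>, known to KH, where \<open>j\<close> ranges over the
  \<open>2\<^sup>w\<close> bit vectors. Using masks \<open>r\<close>, \<open>s\<close> shared by KH and EVH, the helper is sent
  \<open>u \<oplus> r\<close> and \<open>v \<oplus> s\<close> and returns \<open>t = \<langle>u \<oplus> r, v \<oplus> s\<rangle>\<close> to EVH, blinded by a bit \<open>\<rho>\<close> shared by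
  the helper and KH. Since \<open>\<langle>u, v\<rangle> = t \<oplus> \<langle>u, s\<rangle> \<oplus> \<langle>r, v \<oplus> s\<rangle>\<close>, the outputs
  are \<open>c = (t \<oplus> \<rho>) \<oplus> \<langle>u, s\<rangle>\<close> and \<open>k = \<rho> \<oplus> \<langle>r, v \<oplus> s\<rangle>\<close>. Changing the secret
  leaves a view unchanged up to a bijection of the coins: the helper's view is corrected by
  shifting \<open>r\<close>, that of EVH by shifting \<open>K\<close> and \<open>\<rho>\<close>, and KH receives nothing.
\<close>

section \<open>Compiling Boolean expressions\<close>

text \<open>Circuits are given as expressions so that addresses and gate counts follow by recursion.
  The type parameter supplies \<open>set_expr\<close>, the set of cells that are read.\<close>

datatype 'a expr =
  Zero | Var 'a | Neg "'a expr" | And "'a expr" "'a expr" | Xor "'a expr" "'a expr"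

primrec eval :: "memory \<Rightarrow> nat expr \<Rightarrow> bool" where
  "eval m Zero \<longleftrightarrow> False"
| "eval m (Var i) \<longleftrightarrow> read m i"
| "eval m (Neg e) \<longleftrightarrow> \<not> eval m e"
| "eval m (And e f) \<longleftrightarrow> eval m e \<and> eval m f"
| "eval m (Xor e f) \<longleftrightarrow> eval m e \<noteq> eval m f"

text \<open>A leaf counts one gate because \<open>compile\<close> writes it to a fresh cell, by
  \<open>XorI 0 0\<close> or the copy \<open>OrI i i\<close>. Code lengths alone then determine all
  operand addresses.\<close>

primrec gates :: "'a expr \<Rightarrow> nat" where
  "gates Zero = 1"
| "gates (Var i) = 1"
| "gates (Neg e) = gates e + 1"
| "gates (And e f) = gates e + gates f + 1"
| "gates (Xor e f) = gates e + gates f + 1"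

text \<open>
  The argument \<open>n\<close> is the length of the memory on which the code is run; the value of the
  expression ends up in the last cell.
\<close>

primrec compile :: "nat \<Rightarrow> nat expr \<Rightarrow> instr list" where
  "compile n Zero = [XorI 0 0]"
| "compile n (Var i) = [OrI i i]"
| "compile n (Neg e) = compile n e @ [NotI (n + gates e - 1)]"
| "compile n (And e f) = compile n e @ compile (n + gates e) f
     @ [AndI (n + gates e - 1) (n + gates e + gates f - 1)]"
| "compile n (Xor e f) = compile n e @ compile (n + gates e) f
     @ [XorI (n + gates e - 1) (n + gates e + gates f - 1)]"

primrec compile_list :: "nat \<Rightarrow> nat expr list \<Rightarrow> instr list" where
  "compile_list n [] = []"
| "compile_list n (e # es) = compile n e @ compile_list (n + gates e) es"

primrec addresses :: "nat \<Rightarrow> 'a expr list \<Rightarrow> nat list" where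
  "addresses n [] = []"
| "addresses n (e # es) = (n + gates e - 1) # addresses (n + gates e) es"

lemma gates_pos: "0 < gates e"
  by (induction e) auto

lemma length_compile [simp]: "length (compile n e) = gates e"
  by (induction e arbitrary: n) auto

lemma length_compile_list [simp]: "length (compile_list n es) = sum_list (map gates es)"
  by (induction es arbitrary: n) auto

lemma length_addresses [simp]: "length (addresses n es) = length es"
  by (induction es arbitrary: n) auto

section \<open>Append-only memories and correctness of compilation\<close>

lemma run_append [simp]: "run (p @ q) m = run q (run p m)"
  by (simp add: run_def)

lemma run_Nil [simp]: "run [] m = m"
  by (simp add: run_def)

lemma run_single [simp]: "run [c] m = m @ [eval_instr m c]"
  by (simp add: run_def)

lemma length_run [simp]: "length (run p m) = length m + length p"
  by (induction p arbitrary: m) (auto simp: run_def)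

lemma read_append: "i < length m \<Longrightarrow> read (m @ m') i = read m i"
  by (simp add: read_def nth_append)

lemma read_prefix: "prefix m m' \<Longrightarrow> i < length m \<Longrightarrow> read m' i = read m i"
  by (auto simp: prefix_def read_append)

lemma read_run: "i < length m \<Longrightarrow> read (run p m) i = read m i"
  by (rule read_prefix[OF prefix_run])

lemma read_last: "n = length m \<Longrightarrow> read (m @ [b]) n = b"
  by (simp add: read_def)

lemma eval_cong: "(\<And>i. i \<in> set_expr e \<Longrightarrow> read m i = read m' i) \<Longrightarrow> eval m e = eval m' e"
  by (induction e) auto

lemma eval_prefix:
  "prefix m m' \<Longrightarrow> set_expr e \<subseteq> {..<length m} \<Longrightarrow> eval m' e = eval m e"
  by (rule eval_cong) (auto simp: read_prefix subset_iff)

text \<open>Induction for arbitrary \<open>m\<close>, as the second operand runs on a memory already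
  extended by the first. Appending changes neither the variables nor the first result.\<close>

lemma read_run_compile:
  assumes "set_expr e \<subseteq> {..<length m}" "n = length m" "k = length m + gates e - 1"
  shows "read (run (compile n e) m) k = eval m e"
  using assms
proof (induction e arbitrary: m n k)
  case (Neg e)
  then show ?case
    by (simp add: read_last)
next
  case (And e f)
  have "read (run (compile n e) m) (n + gates e - 1) = eval m e"
    using And.prems by (intro And.IH(1)) auto
  moreover have "read (run (compile (n + gates e) f) (run (compile n e) m)) (n + gates e + gates f - 1)
      = eval (run (compile n e) m) f"
    using And.prems by (intro And.IH(2)) auto
  moreover have "eval (run (compile n e) m) f = eval m f"
    using And.prems by (intro eval_prefix prefix_run) auto
  ultimately show ?case
    \<comment> \<open>By \<open>gates_pos\<close>, the first result's address
      \<open>n + gates e - 1\<close> lies in the memory preceding the second block.\<close>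
    using And.prems gates_pos[of e] by (simp add: read_last read_run)
next
  case (Xor e f)
  have "read (run (compile n e) m) (n + gates e - 1) = eval m e"
    using Xor.prems by (intro Xor.IH(1)) auto
  moreover have "read (run (compile (n + gates e) f) (run (compile n e) m)) (n + gates e + gates f - 1)
      = eval (run (compile n e) m) f"
    using Xor.prems by (intro Xor.IH(2)) auto
  moreover have "eval (run (compile n e) m) f = eval m f"
    using Xor.prems by (intro eval_prefix prefix_run) auto
  ultimately show ?case
    using Xor.prems gates_pos[of e] by (simp add: read_last read_run)
qed (auto simp: read_last)

lemma read_run_compile_list:
  assumes "\<forall>e\<in>set es. set_expr e \<subseteq> {..<length m}" "n = length m"
  shows "map (read (run (compile_list n es) m)) (addresses n es) = map (eval m) es"
  using assms
proof (induction es arbitrary: m n)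
  case (Cons e es)
  let ?m = "run (compile n e) m"
  have "map (read (run (compile_list (n + gates e) es) ?m)) (addresses (n + gates e) es)
      = map (eval ?m) es"
    using Cons.prems by (intro Cons.IH) (auto simp: subset_iff intro: trans_less_add1)
  moreover have "map (eval ?m) es = map (eval m) es"
    using Cons.prems by (auto intro!: eval_prefix prefix_run)
  moreover have "read ?m (n + gates e - 1) = eval m e"
    using Cons.prems by (intro read_run_compile) auto
  ultimately show ?case
    using Cons.prems gates_pos[of e] by (simp add: read_run)
qed simp

section \<open>Sums over GF(2) and minterms\<close>

primrec parity :: "nat \<Rightarrow> (nat \<Rightarrow> bool) \<Rightarrow> bool" where
  "parity 0 f \<longleftrightarrow> False"
| "parity (Suc n) f \<longleftrightarrow> parity n f \<noteq> f n"

lemma parity_xor: "parity n (\<lambda>j. f j \<noteq> g j) \<longleftrightarrow> parity n f \<noteq> parity n g"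
  by (induction n) auto

lemma parity_False: "parity n (\<lambda>j. False) \<longleftrightarrow> False"
  by (induction n) auto

lemma parity_single: "parity n (\<lambda>j. j = k) \<longleftrightarrow> k < n"
  by (induction n) auto

lemma parity_cong: "(\<And>j. j < n \<Longrightarrow> f j = g j) \<Longrightarrow> parity n f = parity n g"
  by (induction n) auto

text \<open>Binary expansion: the numbers below \<open>2 ^ w\<close> enumerate the bit vectors of
  length \<open>w\<close> without repetition, so the vector of minterm values is one-hot.\<close>

lemma ex_bits_nat: "\<exists>k < 2 ^ w. \<forall>j < 2 ^ w. (\<forall>i<w. x i = bit j i) \<longleftrightarrow> j = (k::nat)"
proof -
  define k :: nat where "k = horner_sum of_bool 2 (map x [0..<w])"
  have bit_k: "bit k i \<longleftrightarrow> i < w \<and> x i" for i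
    by (auto simp: k_def bit_horner_sum_bit_iff)
  have k: "k < 2 ^ w"
    using horner_sum_of_bool_2_less[of "map x [0..<w]", where ?'a = nat] by (simp add: k_def)
  have "j = k" if "j < 2 ^ w" "\<forall>i<w. x i = bit j i" for j
  proof (rule bit_eqI)
    fix i
    \<comment> \<open>A number below \<open>2 ^ w\<close> has no bits from position \<open>w\<close>
      on, so agreement on the first \<open>w\<close> bits suffices.\<close>
    have "bit j i \<longleftrightarrow> bit (take_bit w j) i"
      using that(1) by (simp add: take_bit_nat_eq_self)
    then show "bit j i \<longleftrightarrow> bit k i"
      using that(2) bit_k by (auto simp: bit_take_bit_iff)
  qed
  then show ?thesis
    using k bit_k by blast
qed

text \<open>Two one-hot vectors: the first is 1 at the index of \<open>x\<close>, the second at that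
  of the complement of \<open>y\<close>. The positions coincide exactly when \<open>x\<close> and
  \<open>y\<close> differ in every bit.\<close>

lemma parity_minterms:
  "parity (2 ^ w) (\<lambda>j. (\<forall>i<w. x i = bit j i) \<and> (\<forall>i<w. y i \<noteq> bit j i)) \<longleftrightarrow> (\<forall>i<w. x i \<noteq> y i)"
proof (cases "\<forall>i<w. x i \<noteq> y i")
  case True
  obtain k where k: "k < 2 ^ w" "\<And>j. j < 2 ^ w \<Longrightarrow> (\<forall>i<w. x i = bit j i) \<longleftrightarrow> j = (k::nat)"
    using ex_bits_nat by metis
  have "parity (2 ^ w) (\<lambda>j. (\<forall>i<w. x i = bit j i) \<and> (\<forall>i<w. y i \<noteq> bit j i))
      = parity (2 ^ w) (\<lambda>j. j = k)"
    using True k(2) by (intro parity_cong) blast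
  then show ?thesis
    using True k(1) by (simp add: parity_single)
next
  case False
  have "parity (2 ^ w) (\<lambda>j. (\<forall>i<w. x i = bit j i) \<and> (\<forall>i<w. y i \<noteq> bit j i))
      = parity (2 ^ w) (\<lambda>j. False)"
    using False by (intro parity_cong) blast
  then show ?thesis
    unfolding parity_False using False by blast
qed

section \<open>Circuits for parities and minterms\<close>

primrec xor_sum :: "nat \<Rightarrow> (nat \<Rightarrow> 'a expr) \<Rightarrow> 'a expr" where
  "xor_sum 0 f = Zero"
| "xor_sum (Suc n) f = Xor (xor_sum n f) (f n)"

text \<open>The first \<open>n\<close> cells are tested because \<open>K\<close> and
  \<open>x\<close> open the memories of KH and EVH.\<close>

primrec minterm :: "nat \<Rightarrow> (nat \<Rightarrow> bool) \<Rightarrow> nat expr" where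
  "minterm 0 b = Neg Zero"
| "minterm (Suc n) b = And (minterm n b) (if b n then Var n else Neg (Var n))"

lemma eval_xor_sum [simp]: "eval m (xor_sum n f) = parity n (\<lambda>j. eval m (f j))"
  by (induction n) auto

lemma eval_minterm [simp]: "eval m (minterm n b) \<longleftrightarrow> (\<forall>i<n. read m i = b i)"
  by (induction n) (simp_all add: All_less_Suc conj_commute)

lemma set_expr_xor_sum [simp]: "set_expr (xor_sum n f) = (\<Union>j<n. set_expr (f j))"
  by (induction n) (auto simp: lessThan_Suc)

lemma set_expr_minterm [simp]: "set_expr (minterm n b) = {..<n}"
  by (induction n) (simp_all add: lessThan_Suc)

lemma gates_xor_sum_le: "(\<And>j. j < n \<Longrightarrow> gates (f j) \<le> c) \<Longrightarrow> gates (xor_sum n f) \<le> n * (c + 1) + 1"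
proof (induction n)
  case (Suc n)
  have "gates (xor_sum n f) \<le> n * (c + 1) + 1" "gates (f n) \<le> c"
    using Suc by auto
  then show ?case
    by simp
qed simp

text \<open>At most three gates per literal (\<open>Var\<close>, \<open>Neg\<close>,
  \<open>And\<close>), and two for \<open>Neg Zero\<close>.\<close>

lemma gates_minterm_le: "gates (minterm n b) \<le> 3 * n + 2"
  by (induction n) auto

section \<open>The protocol\<close>

text \<open>
  Memory layouts, with \<open>N = 2\<^sup>w\<close>: KH starts with \<open>K, r, s, \<rho>\<close>, EVH with \<open>x, r, s\<close>, the helper with
  \<open>\<rho>\<close>; the helper then receives \<open>v \<oplus> s\<close> and \<open>u \<oplus> r\<close>, in this order.
\<close>

definition ind_val :: "nat \<Rightarrow> nat \<Rightarrow> nat expr" where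
  "ind_val w j = minterm w (bit j)"

definition masked_val :: "nat \<Rightarrow> nat \<Rightarrow> nat expr" where
  "masked_val w j = Xor (ind_val w j) (Var (w + j))"

definition masked_key :: "nat \<Rightarrow> nat \<Rightarrow> nat expr" where
  "masked_key w j = Xor (minterm w (\<lambda>i. \<not> bit j i)) (Var (w + 2 ^ w + j))"

definition masked_vals :: "nat \<Rightarrow> nat expr list" where
  "masked_vals w = map (masked_val w) [0..<2 ^ w]"

definition masked_keys :: "nat \<Rightarrow> nat expr list" where
  "masked_keys w = map (masked_key w) [0..<2 ^ w]"

text \<open>Cell 0 holds \<rho>, so this is t \<oplus> \<rho>, the bit returned to EVH.\<close>

definition blinded_product :: "nat \<Rightarrow> nat expr" where
  "blinded_product w = Xor (Var 0) (xor_sum (2 ^ w) (\<lambda>j. And (Var (1 + j)) (Var (1 + 2 ^ w + j))))"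

definition key_len :: "nat \<Rightarrow> nat" where
  "key_len w = w + 2 * 2 ^ w + 1 + sum_list (map gates (masked_keys w))"

text \<open>EVH's memory length when the helper's bit arrives, hence also the address of that
  bit.\<close>

definition val_len :: "nat \<Rightarrow> nat" where
  "val_len w = w + 2 * 2 ^ w + sum_list (map gates (masked_vals w))"

text \<open>The masked keys are recomputed instead of read from their round-one cells, so that only
  initial cells occur; this costs a constant factor.\<close>

definition key_share :: "nat \<Rightarrow> nat expr" where
  "key_share w = Xor (Var (w + 2 * 2 ^ w))
     (xor_sum (2 ^ w) (\<lambda>j. And (Var (w + j)) (masked_key w j)))"

definition val_share :: "nat \<Rightarrow> nat expr" where
  "val_share w = Xor (Var (val_len w))
     (xor_sum (2 ^ w) (\<lambda>j. And (ind_val w j) (Var (w + 2 ^ w + j))))"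

definition round1 :: "nat \<Rightarrow> comm_round" where
  "round1 w = \<lparr>
     ops = (\<lambda>p. case p of
         KH \<Rightarrow> compile_list (w + 2 * 2 ^ w + 1) (masked_keys w)
       | EVH \<Rightarrow> compile_list (w + 2 * 2 ^ w) (masked_vals w)
       | Helper \<Rightarrow> []),
     sent = (\<lambda>p q. if q = Helper then (case p of
         KH \<Rightarrow> addresses (w + 2 * 2 ^ w + 1) (masked_keys w)
       | EVH \<Rightarrow> addresses (w + 2 * 2 ^ w) (masked_vals w)
       | Helper \<Rightarrow> []) else [])\<rparr>"

definition round2 :: "nat \<Rightarrow> comm_round" where
  "round2 w = \<lparr>
     ops = (\<lambda>p. if p = Helper then compile (1 + 2 * 2 ^ w) (blinded_product w) else []),
     sent = (\<lambda>p q. if p = Helper \<and> q = EVH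
       then [1 + 2 * 2 ^ w + gates (blinded_product w) - 1] else [])\<rparr>"

text \<open>KH and EVH share r followed by s; KH and the helper share \<rho>.\<close>

definition and_protocol :: "nat \<Rightarrow> protocol" where
  "and_protocol w = \<lparr>
     num_keys = (\<lambda>pr. case pr of KH_EVH \<Rightarrow> 2 * 2 ^ w | KH_Helper \<Rightarrow> 1 | EVH_Helper \<Rightarrow> 0),
     rounds = [round1 w, round2 w],
     final_ops = (\<lambda>p. case p of
         KH \<Rightarrow> compile (key_len w) (key_share w)
       | EVH \<Rightarrow> compile (val_len w + 1) (val_share w)
       | Helper \<Rightarrow> []),
     out_value = val_len w + 1 + gates (val_share w) - 1,
     out_key = key_len w + gates (key_share w) - 1\<rparr>"

lemma others_simps [simp]:
  "others KH = [EVH, Helper]" "others EVH = [KH, Helper]" "others Helper = [KH, EVH]"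
  by (auto simp: others_def)

lemma set_expr_masked:
  "e \<in> set (masked_keys w) \<Longrightarrow> set_expr e \<subseteq> {..<w + 2 * 2 ^ w}"
  "e \<in> set (masked_vals w) \<Longrightarrow> set_expr e \<subseteq> {..<w + 2 * 2 ^ w}"
  by (auto simp: masked_keys_def masked_vals_def masked_key_def masked_val_def ind_val_def)

definition helper_input ::
    "nat \<Rightarrow> bool list \<Rightarrow> bool list \<Rightarrow> (party_pair \<Rightarrow> bool list) \<Rightarrow> memory" where
  "helper_input w a K R = R KH_Helper
     @ map (eval (init a K R KH)) (masked_keys w) @ map (eval (init a K R EVH)) (masked_vals w)"

text \<open>Semantic counterparts of the circuits: \<open>val_ind\<close> is
  \<open>u\<^sub>j\<close>, \<open>key_ind\<close> is \<open>v\<^sub>j\<close> and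
  \<open>masked_product\<close> is t.\<close>

definition val_ind :: "nat \<Rightarrow> bool list \<Rightarrow> bool list \<Rightarrow> nat \<Rightarrow> bool" where
  "val_ind w a K j \<longleftrightarrow> (\<forall>i<w. (K ! i \<noteq> a ! i) = bit j i)"

definition key_ind :: "nat \<Rightarrow> bool list \<Rightarrow> nat \<Rightarrow> bool" where
  "key_ind w K j \<longleftrightarrow> (\<forall>i<w. K ! i \<noteq> bit j i)"

definition masked_product ::
    "nat \<Rightarrow> bool list \<Rightarrow> bool list \<Rightarrow> (party_pair \<Rightarrow> bool list) \<Rightarrow> bool" where
  "masked_product w a K R \<longleftrightarrow> parity (2 ^ w)
     (\<lambda>j. (key_ind w K j \<noteq> R KH_EVH ! (2 ^ w + j)) \<and> (val_ind w a K j \<noteq> R KH_EVH ! j))"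

section \<open>Memories and messages in a run\<close>

context
  fixes w :: nat and a K :: "bool list" and R :: "party_pair \<Rightarrow> bool list"
  assumes len_a: "length a = w" and coins: "(K, R) \<in> coins w (and_protocol w)"
begin

lemma lengths:
  "length K = w" "length (R KH_EVH) = 2 * 2 ^ w" "length (R KH_Helper) = 1" "R EVH_Helper = []"
  using coins by (auto simp: coins_def and_protocol_def dest: spec[of _ EVH_Helper])

lemma length_init:
  "length (init a K R KH) = w + 2 * 2 ^ w + 1" "length (init a K R EVH) = w + 2 * 2 ^ w"
  using lengths len_a by auto

lemma length_helper_input: "length (helper_input w a K R) = 1 + 2 * 2 ^ w"
  using lengths by (simp add: helper_input_def masked_keys_def masked_vals_def)

lemma messages_round1:
  "map (read (run (compile_list (w + 2 * 2 ^ w + 1) (masked_keys w)) (init a K R KH)))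
     (addresses (w + 2 * 2 ^ w + 1) (masked_keys w)) = map (eval (init a K R KH)) (masked_keys w)"
  "map (read (run (compile_list (w + 2 * 2 ^ w) (masked_vals w)) (init a K R EVH)))
     (addresses (w + 2 * 2 ^ w) (masked_vals w)) = map (eval (init a K R EVH)) (masked_vals w)"
proof -
  have "\<forall>e\<in>set (masked_keys w). set_expr e \<subseteq> {..<length (init a K R KH)}"
    unfolding length_init using set_expr_masked(1)[of _ w] by fastforce
  then show "map (read (run (compile_list (w + 2 * 2 ^ w + 1) (masked_keys w)) (init a K R KH)))
     (addresses (w + 2 * 2 ^ w + 1) (masked_keys w)) = map (eval (init a K R KH)) (masked_keys w)"
    by (rule read_run_compile_list) (simp only: length_init)
  have "\<forall>e\<in>set (masked_vals w). set_expr e \<subseteq> {..<length (init a K R EVH)}"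
    unfolding length_init using set_expr_masked(2)[of _ w] by blast
  then show "map (read (run (compile_list (w + 2 * 2 ^ w) (masked_vals w)) (init a K R EVH)))
     (addresses (w + 2 * 2 ^ w) (masked_vals w)) = map (eval (init a K R EVH)) (masked_vals w)"
    by (rule read_run_compile_list) (simp only: length_init)
qed

lemma message_round2:
  "read (run (compile (1 + 2 * 2 ^ w) (blinded_product w)) (helper_input w a K R))
     (1 + 2 * 2 ^ w + gates (blinded_product w) - 1) = eval (helper_input w a K R) (blinded_product w)"
  by (rule read_run_compile) (auto simp: length_helper_input blinded_product_def)

lemma final_memory_KH:
  "final_memory (and_protocol w) a K R KH = run (compile (key_len w) (key_share w))
     (run (compile_list (w + 2 * 2 ^ w + 1) (masked_keys w)) (init a K R KH))"
  by (simp add: final_memory_def execute_def and_protocol_def do_round_def Let_def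
      round1_def round2_def del: init.simps)

text \<open>In this form the view is a function of EVH's initial memory and the one received bit,
  which is what the security argument compares.\<close>

lemma final_memory_EVH:
  "final_memory (and_protocol w) a K R EVH = run (compile (val_len w + 1) (val_share w))
     (run (compile_list (w + 2 * 2 ^ w) (masked_vals w)) (init a K R EVH)
      @ [eval (helper_input w a K R) (blinded_product w)])"
  using message_round2 lengths(4)
  by (simp add: final_memory_def execute_def and_protocol_def do_round_def Let_def
      round1_def round2_def messages_round1[folded Suc_eq_plus1] helper_input_def del: init.simps(1,2))

lemma final_memory_Helper:
  "final_memory (and_protocol w) a K R Helper =
     run (compile (1 + 2 * 2 ^ w) (blinded_product w)) (helper_input w a K R)"
  using lengths(4)
  by (simp add: final_memory_def execute_def and_protocol_def do_round_def Let_def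
      round1_def round2_def messages_round1[folded Suc_eq_plus1] helper_input_def del: init.simps(1,2))

lemma read_init:
  "i < w \<Longrightarrow> read (init a K R KH) i = K ! i"
  "i < w \<Longrightarrow> read (init a K R EVH) i = (K ! i \<noteq> a ! i)"
  "j < 2 * 2 ^ w \<Longrightarrow> read (init a K R KH) (w + j) = R KH_EVH ! j"
  "j < 2 * 2 ^ w \<Longrightarrow> read (init a K R EVH) (w + j) = R KH_EVH ! j"
  "read (init a K R KH) (w + 2 * 2 ^ w) = R KH_Helper ! 0"
  using lengths len_a by (auto simp: read_def nth_append enc_def)

lemma eval_ind_val: "eval (init a K R EVH) (ind_val w j) \<longleftrightarrow> val_ind w a K j"
  by (simp add: ind_val_def val_ind_def read_init del: init.simps)

lemma eval_masked_val: "j < 2 ^ w \<Longrightarrow> eval (init a K R EVH) (masked_val w j) \<longleftrightarrow> val_ind w a K j \<noteq> R KH_EVH ! j"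
  by (simp add: masked_val_def eval_ind_val read_init del: init.simps)

lemma eval_masked_key: "j < 2 ^ w \<Longrightarrow> eval (init a K R KH) (masked_key w j) \<longleftrightarrow> key_ind w K j \<noteq> R KH_EVH ! (2 ^ w + j)"
  using read_init(3)[of "2 ^ w + j"]
  by (simp add: masked_key_def key_ind_def read_init(1) add.assoc del: init.simps)

lemma read_helper_input:
  "read (helper_input w a K R) 0 = R KH_Helper ! 0"
  "j < 2 ^ w \<Longrightarrow> read (helper_input w a K R) (1 + j) \<longleftrightarrow> key_ind w K j \<noteq> R KH_EVH ! (2 ^ w + j)"
  "j < 2 ^ w \<Longrightarrow> read (helper_input w a K R) (1 + 2 ^ w + j) \<longleftrightarrow> val_ind w a K j \<noteq> R KH_EVH ! j"
  using lengths(3)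
  by (auto simp: read_def helper_input_def masked_keys_def masked_vals_def nth_append
      eval_masked_key eval_masked_val simp del: init.simps)

lemma eval_blinded_product:
  "eval (helper_input w a K R) (blinded_product w) \<longleftrightarrow>
     R KH_Helper ! 0 \<noteq> masked_product w a K R"
proof -
  have "parity (2 ^ w) (\<lambda>j. read (helper_input w a K R) (1 + j) \<and> read (helper_input w a K R) (1 + 2 ^ w + j))
     = masked_product w a K R"
    unfolding masked_product_def using read_helper_input(2,3) by (intro parity_cong) blast
  then show ?thesis
    by (simp add: blinded_product_def read_helper_input(1))
qed

section \<open>Correctness of the outputs\<close>

lemma output_key:
  "read (final_memory (and_protocol w) a K R KH) (out_key (and_protocol w)) \<longleftrightarrow>
     R KH_Helper ! 0 \<noteq> parity (2 ^ w) (\<lambda>j. R KH_EVH ! j \<and> (key_ind w K j \<noteq> R KH_EVH ! (2 ^ w + j)))"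
proof -
  let ?m = "run (compile_list (w + 2 * 2 ^ w + 1) (masked_keys w)) (init a K R KH)"
  have len: "length ?m = key_len w"
    by (simp add: length_init key_len_def del: init.simps)
  have sub: "set_expr (key_share w) \<subseteq> {..<length (init a K R KH)}"
    unfolding length_init by (auto simp: key_share_def masked_key_def)
  have "read (run (compile (key_len w) (key_share w)) ?m) (key_len w + gates (key_share w) - 1)
      = eval ?m (key_share w)"
    using sub len by (intro read_run_compile) (auto simp: length_init simp del: init.simps)
  also have "\<dots> = eval (init a K R KH) (key_share w)"
    using sub by (intro eval_prefix prefix_run)
  also have "\<dots> \<longleftrightarrow> R KH_Helper ! 0 \<noteq> parity (2 ^ w) (\<lambda>j. R KH_EVH ! j \<and> (key_ind w K j \<noteq> R KH_EVH ! (2 ^ w + j)))"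
    using parity_cong[of "2 ^ w"
        "\<lambda>j. read (init a K R KH) (w + j) \<and> eval (init a K R KH) (masked_key w j)"
        "\<lambda>j. R KH_EVH ! j \<and> (key_ind w K j \<noteq> R KH_EVH ! (2 ^ w + j))"]
    by (simp add: key_share_def read_init eval_masked_key del: init.simps)
  also have "key_len w + gates (key_share w) - 1 = out_key (and_protocol w)"
    by (simp add: and_protocol_def)
  finally show ?thesis
    unfolding final_memory_KH .
qed

lemma output_value:
  "read (final_memory (and_protocol w) a K R EVH) (out_value (and_protocol w)) \<longleftrightarrow>
     eval (helper_input w a K R) (blinded_product w) \<noteq> parity (2 ^ w) (\<lambda>j. val_ind w a K j \<and> R KH_EVH ! (2 ^ w + j))"
proof -
  let ?b = "eval (helper_input w a K R) (blinded_product w)"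
  let ?m = "run (compile_list (w + 2 * 2 ^ w) (masked_vals w)) (init a K R EVH) @ [?b]"
  let ?e = "xor_sum (2 ^ w) (\<lambda>j. And (ind_val w j) (Var (w + 2 ^ w + j)))"
  have len: "length ?m = val_len w + 1"
    by (simp add: length_init val_len_def del: init.simps)
  have sub: "set_expr ?e \<subseteq> {..<length (init a K R EVH)}"
    unfolding length_init by (auto simp: ind_val_def)
  have "read (run (compile (val_len w + 1) (val_share w)) ?m) (val_len w + 1 + gates (val_share w) - 1)
      = eval ?m (val_share w)"
    using sub len
    by (intro read_run_compile) (auto simp: length_init val_share_def val_len_def simp del: init.simps)
  \<comment> \<open>\<open>Var (val_len w)\<close> reads the last cell, the helper's bit; the
    remaining sum reads initial cells only.\<close>
  also have "\<dots> \<longleftrightarrow> ?b \<noteq> eval ?m ?e"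
    using len by (simp add: val_share_def read_last)
  also have "eval ?m ?e = eval (init a K R EVH) ?e"
    using sub by (intro eval_prefix prefix_prefix prefix_run)
  also have "\<dots> = parity (2 ^ w) (\<lambda>j. val_ind w a K j \<and> R KH_EVH ! (2 ^ w + j))"
    using read_init(4)[of "2 ^ w + _"]
    by (auto simp: eval_ind_val add.assoc simp del: init.simps intro!: parity_cong)
  also have "val_len w + 1 + gates (val_share w) - 1 = out_value (and_protocol w)"
    by (simp add: and_protocol_def)
  finally show ?thesis
    unfolding final_memory_EVH .
qed

lemma outputs_correct:
  "read (final_memory (and_protocol w) a K R EVH) (out_value (and_protocol w)) \<noteq>
     read (final_memory (and_protocol w) a K R KH) (out_key (and_protocol w)) \<longleftrightarrow> (\<forall>i<w. a ! i)"
proof -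
  \<comment> \<open>Pointwise over GF(2): uv = (v + s)(u + r) + us + r(v + s). Summing gives the two
    shares, in which \<rho> cancels.\<close>
  have "parity (2 ^ w) (\<lambda>j. val_ind w a K j \<and> key_ind w K j) = parity (2 ^ w) (\<lambda>j.
      (((key_ind w K j \<noteq> R KH_EVH ! (2 ^ w + j)) \<and> (val_ind w a K j \<noteq> R KH_EVH ! j)) \<noteq> (val_ind w a K j \<and> R KH_EVH ! (2 ^ w + j))) \<noteq> (R KH_EVH ! j \<and> (key_ind w K j \<noteq> R KH_EVH ! (2 ^ w + j))))"
    by (rule arg_cong[where f = "parity _"]) blast
  \<comment> \<open>Here x = K \<oplus> a and y = K, which differ at position i exactly when
    \<open>a ! i\<close> holds.\<close>
  moreover have "parity (2 ^ w) (\<lambda>j. val_ind w a K j \<and> key_ind w K j) \<longleftrightarrow> (\<forall>i<w. a ! i)"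
    unfolding val_ind_def key_ind_def parity_minterms by blast
  ultimately show ?thesis
    unfolding output_value output_key eval_blinded_product masked_product_def parity_xor by blast
qed

end

theorem evaluates_and_and_protocol: "evaluates_and w (and_protocol w)"
  unfolding evaluates_and_def using outputs_correct by blast

section \<open>Security\<close>

text \<open>A bijection of the coins preserves their uniform distribution, so views that match coin
  by coin have equal distributions.\<close>

lemma view_dist_eqI:
  assumes "\<And>z. z \<in> coins w P \<Longrightarrow> \<phi> z \<in> coins w P \<and> \<psi> (\<phi> z) = z"
    and "\<And>z. z \<in> coins w P \<Longrightarrow> \<psi> z \<in> coins w P \<and> \<phi> (\<psi> z) = z"
    and "\<And>K R K' R'. (K, R) \<in> coins w P \<Longrightarrow> \<phi> (K, R) = (K', R') \<Longrightarrow>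
      final_memory P b K' R' p = final_memory P a K R p"
  shows "view_dist w P a p = view_dist w P b p"
proof -
  have "bij_betw \<phi> (coins w P) (coins w P)"
    using assms(1,2) by (intro bij_betw_byWitness[where f' = \<psi>]) auto
  then have "pmf_of_set (coins w P) = map_pmf \<phi> (pmf_of_set (coins w P))"
    using coins_nonempty finite_coins by (simp add: map_pmf_of_set_bij_betw)
  then have "view_dist w P b p
      = map_pmf (\<lambda>(K, R). final_memory P b K R p) (map_pmf \<phi> (pmf_of_set (coins w P)))"
    unfolding view_dist_def by simp
  also have "\<dots> = view_dist w P a p"
    unfolding view_dist_def map_pmf_comp
    using coins_nonempty finite_coins
    by (intro map_pmf_cong) (auto split: prod.splits intro: assms(3))
  finally show ?thesis
    by simp
qed

lemma coins_and_protocol: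
  "(K, R) \<in> coins w (and_protocol w) \<longleftrightarrow>
     length K = w \<and> length (R KH_EVH) = 2 * 2 ^ w \<and> length (R KH_Helper) = 1 \<and> R EVH_Helper = []"
  by (auto simp: coins_def and_protocol_def split: party_pair.splits dest: spec[of _ EVH_Helper])

text \<open>The identity suffices: KH receives nothing and its initial memory does not involve the
  secret.\<close>

lemma view_KH:
  assumes "length a = w" "length b = w"
  shows "view_dist w (and_protocol w) a KH = view_dist w (and_protocol w) b KH"
  using assms
  by (intro view_dist_eqI[where \<phi> = id and \<psi> = id]) (auto simp: final_memory_KH)

text \<open>Adding the change of u to r keeps u \<oplus> r fixed. The guard \<open>j < 2 ^ w\<close>
  confines the shift to r; with K and s untouched, v \<oplus> s is fixed too.\<close>

definition shift_vals ::
    "nat \<Rightarrow> bool list \<Rightarrow> bool list \<Rightarrow> bool list \<times> (party_pair \<Rightarrow> bool list)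
     \<Rightarrow> bool list \<times> (party_pair \<Rightarrow> bool list)" where
  "shift_vals w a b = (\<lambda>(K, R). (K, R(KH_EVH :=
     map (\<lambda>j. R KH_EVH ! j \<noteq> (j < 2 ^ w \<and> val_ind w a K j \<noteq> val_ind w b K j)) [0..<2 * 2 ^ w])))"

lemma shift_vals_coins: "z \<in> coins w (and_protocol w) \<Longrightarrow> shift_vals w a b z \<in> coins w (and_protocol w)"
  by (cases z) (auto simp: shift_vals_def coins_and_protocol)

lemma shift_vals_involution:
  assumes "z \<in> coins w (and_protocol w)"
  shows "shift_vals w a b (shift_vals w a b z) = z"
proof -
  obtain K R where z: "z = (K, R)"
    by (cases z)
  have "map (\<lambda>j. snd (shift_vals w a b z) KH_EVH ! j
      \<noteq> (j < 2 ^ w \<and> val_ind w a K j \<noteq> val_ind w b K j)) [0..<2 * 2 ^ w] = R KH_EVH"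
    using assms by (intro nth_equalityI) (auto simp: z coins_and_protocol shift_vals_def)
  then show ?thesis
    by (simp add: z shift_vals_def)
qed

lemma view_Helper:
  assumes "length a = w" "length b = w"
  shows "view_dist w (and_protocol w) a Helper = view_dist w (and_protocol w) b Helper"
proof (rule view_dist_eqI[where \<phi> = "shift_vals w a b" and \<psi> = "shift_vals w a b"])
  fix K R K' R'
  assume coins: "(K, R) \<in> coins w (and_protocol w)" and eq: "shift_vals w a b (K, R) = (K', R')"
  have coins': "(K', R') \<in> coins w (and_protocol w)"
    using shift_vals_coins[OF coins] eq by metis
  have [simp]: "K' = K" "R' KH_Helper = R KH_Helper"
    and R': "\<And>j. j < 2 ^ w \<Longrightarrow>
      R' KH_EVH ! j \<longleftrightarrow> R KH_EVH ! j \<noteq> (val_ind w a K j \<noteq> val_ind w b K j)"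
      "\<And>j. j < 2 ^ w \<Longrightarrow> R' KH_EVH ! (2 ^ w + j) = R KH_EVH ! (2 ^ w + j)"
    using eq by (auto simp: shift_vals_def)
  have "eval (init b K' R' KH) (masked_key w j) = eval (init a K R KH) (masked_key w j)"
    "eval (init b K' R' EVH) (masked_val w j) = eval (init a K R EVH) (masked_val w j)"
    if "j < 2 ^ w" for j
    using eval_masked_key[OF assms(1) coins that] eval_masked_key[OF assms(2) coins' that]
      eval_masked_val[OF assms(1) coins that] eval_masked_val[OF assms(2) coins' that] R'[OF that]
    by (auto simp del: init.simps)
  then have "helper_input w b K' R' = helper_input w a K R"
    by (simp add: helper_input_def masked_keys_def masked_vals_def del: init.simps)
  then show "final_memory (and_protocol w) b K' R' Helper = final_memory (and_protocol w) a K R Helper"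
    unfolding final_memory_Helper[OF assms(1) coins] final_memory_Helper[OF assms(2) coins'] by simp
qed (use shift_vals_coins shift_vals_involution in auto)

text \<open>Shifting K by a \<oplus> b keeps EVH's encrypted values fixed. It changes v and thereby
  t, so \<rho> absorbs the change of t; r and s, known to EVH, stay.\<close>

definition shift_keys ::
    "nat \<Rightarrow> bool list \<Rightarrow> bool list \<Rightarrow> bool list \<times> (party_pair \<Rightarrow> bool list)
     \<Rightarrow> bool list \<times> (party_pair \<Rightarrow> bool list)" where
  "shift_keys w a b = (\<lambda>(K, R). let K' = map (\<lambda>i. K ! i \<noteq> (a ! i \<noteq> b ! i)) [0..<w] in
     (K', R(KH_Helper :=
       [R KH_Helper ! 0 \<noteq> (masked_product w a K R \<noteq> masked_product w b K' R)])))"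

lemma masked_product_upd [simp]:
  "masked_product w a K (R(KH_Helper := xs)) = masked_product w a K R"
  by (simp add: masked_product_def)

lemma shift_keys_coins: "z \<in> coins w (and_protocol w) \<Longrightarrow> shift_keys w a b z \<in> coins w (and_protocol w)"
  by (cases z) (auto simp: shift_keys_def coins_and_protocol Let_def)

text \<open>Going back exchanges \<open>a\<close> and \<open>b\<close>. As t does not involve
  \<rho>, both directions correct \<rho> by the same pair of products, and the corrections
  cancel.\<close>

lemma shift_keys_inverse:
  assumes "z \<in> coins w (and_protocol w)"
  shows "shift_keys w b a (shift_keys w a b z) = z"
proof -
  obtain K R where z: "z = (K, R)"
    by (cases z)
  have K: "map (\<lambda>i. map (\<lambda>i. K ! i \<noteq> (a ! i \<noteq> b ! i)) [0..<w] ! i \<noteq> (b ! i \<noteq> a ! i)) [0..<w] = K"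
    using assms by (intro nth_equalityI) (auto simp: z coins_and_protocol)
  have "[R KH_Helper ! 0] = R KH_Helper"
    using assms by (auto simp: z coins_and_protocol length_Suc_conv)
  moreover have "((x \<noteq> (y \<noteq> y')) \<noteq> (y' \<noteq> y)) = x" for x y y' :: bool
    by blast
  ultimately show ?thesis
    unfolding z shift_keys_def Let_def prod.case K
    by (simp add: fun_upd_idem)
qed

lemma view_EVH:
  assumes "length a = w" "length b = w"
  shows "view_dist w (and_protocol w) a EVH = view_dist w (and_protocol w) b EVH"
proof (rule view_dist_eqI[where \<phi> = "shift_keys w a b" and \<psi> = "shift_keys w b a"])
  fix K R K' R'
  assume coins: "(K, R) \<in> coins w (and_protocol w)" and eq: "shift_keys w a b (K, R) = (K', R')"
  have coins': "(K', R') \<in> coins w (and_protocol w)"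
    using shift_keys_coins[OF coins] eq by metis
  have K': "K' = map (\<lambda>i. K ! i \<noteq> (a ! i \<noteq> b ! i)) [0..<w]"
    and R': "R' = R(KH_Helper :=
      [R KH_Helper ! 0 \<noteq> (masked_product w a K R \<noteq> masked_product w b K' R)])"
    using eq by (auto simp: shift_keys_def Let_def)
  have "map2 enc K' b = map2 enc K a"
    using assms coins by (intro nth_equalityI) (auto simp: K' enc_def coins_and_protocol)
  then have "init b K' R' EVH = init a K R EVH"
    by (simp add: R')
  \<comment> \<open>The correction of \<rho> cancels the change of t.\<close>
  moreover have "eval (helper_input w b K' R') (blinded_product w)
      = eval (helper_input w a K R) (blinded_product w)"
    unfolding eval_blinded_product[OF assms(1) coins] eval_blinded_product[OF assms(2) coins']
    by (auto simp: R')
  ultimately show "final_memory (and_protocol w) b K' R' EVH = final_memory (and_protocol w) a K R EVH"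
    unfolding final_memory_EVH[OF assms(1) coins] final_memory_EVH[OF assms(2) coins'] by simp
qed (use shift_keys_coins shift_keys_inverse in auto)

theorem perfectly_secure_and_protocol: "perfectly_secure w (and_protocol w)"
proof -
  have "view_dist w (and_protocol w) a p = view_dist w (and_protocol w) b p"
    if "length a = w" "length b = w" for p a b
    using that by (cases p) (auto intro: view_KH view_EVH view_Helper)
  then show ?thesis
    by (simp add: perfectly_secure_def)
qed

section \<open>Costs\<close>

lemma message_bits_and_protocol: "message_bits (and_protocol w) = 2 * 2 ^ w + 1"
  by (simp add: message_bits_def and_protocol_def round1_def round2_def
      masked_keys_def masked_vals_def)

lemma gates_masked_le: "gates (masked_val w j) \<le> 3 * w + 4" "gates (masked_key w j) \<le> 3 * w + 4"
  using gates_minterm_le[of w "bit j"] gates_minterm_le[of w "\<lambda>i. \<not> bit j i"]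
  by (auto simp: masked_val_def masked_key_def ind_val_def)

text \<open>Four families of minterms give the \<open>12 * w\<close>. The 9 counts
  \<open>Zero\<close>, the outer \<open>Var\<close> and the outer \<open>Xor\<close> in each of the
  three sums.\<close>

lemma bit_operations_and_protocol_le:
  "bit_operations (and_protocol w) \<le> 2 ^ w * (12 * w + 27) + 9"
proof -
  have "sum_list (map gates (masked_keys w)) \<le> 2 ^ w * (3 * w + 4)"
    using sum_list_mono[of "[0..<2 ^ w]" "\<lambda>j. gates (masked_key w j)" "\<lambda>_. 3 * w + 4"]
    by (simp add: masked_keys_def o_def gates_masked_le sum_list_triv)
  moreover have "sum_list (map gates (masked_vals w)) \<le> 2 ^ w * (3 * w + 4)"
    using sum_list_mono[of "[0..<2 ^ w]" "\<lambda>j. gates (masked_val w j)" "\<lambda>_. 3 * w + 4"]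
    by (simp add: masked_vals_def o_def gates_masked_le sum_list_triv)
  moreover have "gates (blinded_product w) \<le> 2 ^ w * (3 + 1) + 3"
    using gates_xor_sum_le[of "2 ^ w" "\<lambda>j. And (Var (1 + j)) (Var (1 + 2 ^ w + j))" 3]
    by (simp add: blinded_product_def)
  moreover have "gates (key_share w) \<le> 2 ^ w * (3 * w + 6 + 1) + 3"
    using gates_xor_sum_le[of "2 ^ w" "\<lambda>j. And (Var (w + j)) (masked_key w j)" "3 * w + 6"]
      gates_masked_le(2)[of w]
    by (simp add: key_share_def add.commute)
  moreover have "gates (val_share w) \<le> 2 ^ w * (3 * w + 4 + 1) + 3"
    using gates_xor_sum_le[of "2 ^ w" "\<lambda>j. And (ind_val w j) (Var (w + 2 ^ w + j))" "3 * w + 4"]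
      gates_minterm_le
    by (simp add: val_share_def ind_val_def)
  moreover have "bit_operations (and_protocol w) =
      sum_list (map gates (masked_keys w)) + sum_list (map gates (masked_vals w))
      + gates (blinded_product w) + gates (key_share w) + gates (val_share w)"
    by (simp add: bit_operations_def and_protocol_def round1_def round2_def)
  ultimately show ?thesis
    by (simp add: algebra_simps)
qed

theorem theorem8:
  "\<exists>P :: nat \<Rightarrow> protocol.
     (\<forall>w\<ge>2. length (rounds (P w)) = 2 \<and> evaluates_and w (P w) \<and> perfectly_secure w (P w)) \<and>
     (\<lambda>w. real (message_bits (P w))) \<in> O(\<lambda>w. 2 ^ w) \<and>
     (\<lambda>w. real (bit_operations (P w))) \<in> O(\<lambda>w. real w * 2 ^ w)"
proof (intro exI[of _ and_protocol] conjI allI impI)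
  show "length (rounds (and_protocol w)) = 2" for w
    by (simp add: and_protocol_def)
  show "(\<lambda>w. real (message_bits (and_protocol w))) \<in> O(\<lambda>w. 2 ^ w)"
    \<comment> \<open>The constant 3 comes from
      \<open>2 * 2 ^ w + 1 \<le> 3 * 2 ^ w\<close>.\<close>
    by (rule bigoI[of _ 3]) (simp add: message_bits_and_protocol)
  show "(\<lambda>w. real (bit_operations (and_protocol w))) \<in> O(\<lambda>w. real w * 2 ^ w)"
  \<comment> \<open>After the 9 is absorbed into \<open>9 * 2 ^ w\<close>, the factor is
    \<open>12 * w + 36\<close>, at most \<open>48 * w\<close> once \<open>w \<ge> 1\<close>; at
    \<open>w = 0\<close> the comparison function vanishes.\<close>
  proof (rule bigoI[of _ 48], rule eventually_sequentiallyI[of 1])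
    fix w :: nat
    assume w: "1 \<le> w"
    have "2 ^ w * (12 * w + 27) + 9 \<le> 2 ^ w * (12 * w + 27) + 2 ^ w * (9 :: nat)"
      by simp
    also have "\<dots> = 2 ^ w * (12 * w + 36)"
      by (simp add: algebra_simps)
    also have "\<dots> \<le> 2 ^ w * (48 * w)"
      using w by (intro mult_left_mono) auto
    finally have "bit_operations (and_protocol w) \<le> 48 * (w * 2 ^ w)"
      using bit_operations_and_protocol_le[of w] by (simp add: algebra_simps)
    then have "real (bit_operations (and_protocol w)) \<le> real (48 * (w * 2 ^ w))"
      by (rule of_nat_mono)
    then show "norm (real (bit_operations (and_protocol w))) \<le> 48 * norm (real w * 2 ^ w)"
      by simp
  qed
qed (rule evaluates_and_and_protocol perfectly_secure_and_protocol)+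

end
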